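(* Let $\ell\ge 1$ and $g\geq 3\ell -1$ be integers and let $v=(v_1,\dots, v_{2\ell})$ be any $(0/1)$-vector where half of the entries are $0$ and the other half are $1$. Then: (i) $\Lambda_{g,v}$ is a numerical semigroup of genus $g$. (ii) $Gaps(\Lambda_{g,v}) \setminus PF(\Lambda_{g,v})=\{ j-i: 1\leq i<j\leq 2\ell,\ v_i=0,\ v_j=1\}$. (iii) $t(\Lambda_{g,v})=g-|\{ j-i: 1\leq i<j\leq 2\ell,\ v_i=0,\ v_j=1\}|$.
   Context: A numerical semigroup $\Lambda$ is a subset of $\mathbb{N}_0$ containing $0$, closed under addition, with finite complement in $\mathbb{N}_0$. The elements of $Gaps(\Lambda)=\mathbb{N}_0\setminus\Lambda$ are its gaps, and the genus $g(\Lambda)$ is the number of gaps. The set of pseudo-Frobenius numbers is $PF(\Lambda)=\{x\in\mathbb{Z}\setminus\Lambda : x+\lambda\in\Lambda \text{ for all } \lambda\in\Lambda\setminus\{0\}\}$ and the type is $t(\Lambda)=|PF(\Lambda)|$. For a $(0/1)$-vector $v=(v_1,\dots,v_{2\ell})$ and an integer $g>\ell$, set $$\mathcal{G}_{g,v}=\{1,\dots,g-\ell\}\cup\{g-\ell+i : 1\le i\le 2\ell \text{ and } v_i=1\},\qquad \Lambda_{g,v}=\mathbb{N}_0\setminus\mathcal{G}_{g,v}.$$ *)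

theory Defs
  imports Main
begin

definition gaps :: "nat set \<Rightarrow> nat set" where
  "gaps \<Lambda> = UNIV - \<Lambda>"

definition numerical_semigroup :: "nat set \<Rightarrow> bool" where
  "numerical_semigroup \<Lambda> \<longleftrightarrow>
     0 \<in> \<Lambda> \<and> (\<forall>a\<in>\<Lambda>. \<forall>b\<in>\<Lambda>. a + b \<in> \<Lambda>) \<and> finite (gaps \<Lambda>)"

definition genus :: "nat set \<Rightarrow> nat" where
  "genus \<Lambda> = card (gaps \<Lambda>)"

(* Pseudo-Frobenius numbers are integers and may be negative: PF(UNIV) = {-1}. *)
definition pseudo_frobenius :: "nat set \<Rightarrow> int set" where
  "pseudo_frobenius \<Lambda> =
     {x. x \<notin> int ` \<Lambda> \<and> (\<forall>l \<in> \<Lambda> - {0}. x + int l \<in> int ` \<Lambda>)}"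

definition semigroup_type :: "nat set \<Rightarrow> nat" where
  "semigroup_type \<Lambda> = card (pseudo_frobenius \<Lambda>)"

(* A vector (v_1, ..., v_2l) is a function on nat of which only the values at 1, ..., 2l
   are used; the half-length l is therefore an explicit argument.  The truncated
   subtraction g - l is intended for g > l only. *)
definition gap_set :: "nat \<Rightarrow> nat \<Rightarrow> (nat \<Rightarrow> nat) \<Rightarrow> nat set" where
  "gap_set l g v = {1..g - l} \<union> {g - l + i | i. 1 \<le> i \<and> i \<le> 2 * l \<and> v i = 1}"

definition Lambda :: "nat \<Rightarrow> nat \<Rightarrow> (nat \<Rightarrow> nat) \<Rightarrow> nat set" where
  "Lambda l g v = UNIV - gap_set l g v"

end

theory Submission
  imports Defs
begin

text \<open>Every nonzero element of \<open>\<Lambda>\<close> exceeds \<open>g - l\<close>, so a sum of two of them exceeds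
  \<open>g + l\<close>, the end of the window that contains all gaps; hence \<open>\<Lambda>\<close> is a semigroup. If \<open>x\<close>
  is a gap and \<open>x + \<lambda>\<close> is again a gap for some nonzero \<open>\<lambda>\<close> in \<open>\<Lambda>\<close>, then both
  \<open>\<lambda> = g - l + i\<close> and \<open>x + \<lambda> = g - l + j\<close> lie in the window, so \<open>x = j - i\<close>.
  Conversely \<open>j - i \<le> 2l - 1 \<le> g - l\<close> is always a gap.\<close>

lemma gaps_Lambda [simp]: "gaps (Lambda l g v) = gap_set l g v"
  by (auto simp: gaps_def Lambda_def)

lemma finite_gap_set [simp]: "finite (gap_set l g v)"
  by (rule finite_subset[of _ "{..g - l + 2 * l}"]) (auto simp: gap_set_def)

text \<open>Window indices start at 1, so the window misses the initial block; with \<open>l\<close>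
  ones in \<open>v\<close> and \<open>l \<le> g\<close> the total is \<open>g\<close>.\<close>

lemma card_gap_set:
  "card (gap_set l g v) = (g - l) + card {i \<in> {1..2 * l}. v i = 1}"
proof -
  let ?I = "{i \<in> {1..2 * l}. v i = 1}"
  have "gap_set l g v = {1..g - l} \<union> (+) (g - l) ` ?I"
    by (auto simp: gap_set_def)
  moreover have "card ({1..g - l} \<union> (+) (g - l) ` ?I) = card {1..g - l} + card ((+) (g - l) ` ?I)"
    by (rule card_Un_disjoint) auto
  ultimately show ?thesis
    by (simp add: card_image)
qed

lemma numerical_semigroup_Lambda:
  assumes "3 * l \<le> g + 1"
  shows "numerical_semigroup (Lambda l g v)"
  unfolding numerical_semigroup_def
proof (intro conjI ballI)
  show "0 \<in> Lambda l g v"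
    by (auto simp: Lambda_def gap_set_def)
  show "finite (gaps (Lambda l g v))"
    by simp
  fix a b assume ab: "a \<in> Lambda l g v" "b \<in> Lambda l g v"
  show "a + b \<in> Lambda l g v"
  proof (cases "a = 0 \<or> b = 0")
    case True
    with ab show ?thesis by auto
  next
    case False
    with ab have "a > g - l" "b > g - l"
      by (auto simp: Lambda_def gap_set_def)
    \<comment> \<open>\<open>a + b \<ge> 2 * (g - l) + 2 \<ge> g + l + 1\<close>, where the last
      inequality is exactly \<open>3 * l \<le> g + 1\<close>.\<close>
    with assms show ?thesis
      by (auto simp: Lambda_def gap_set_def)
  qed
qed

text \<open>Only negative integers have to be excluded. \<open>UNIV\<close> is ruled out because -1
  is pseudo-Frobenius there.\<close>

lemma pseudo_frobenius_subset_gaps: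
  assumes fin: "finite (gaps \<Lambda>)" and ne: "\<Lambda> \<noteq> UNIV"
  shows "pseudo_frobenius \<Lambda> \<subseteq> int ` gaps \<Lambda>"
proof
  fix x assume x: "x \<in> pseudo_frobenius \<Lambda>"
  have "x \<ge> 0"
  proof (rule ccontr)
    assume "\<not> x \<ge> 0"
    then obtain k where k: "k > 0" "x = - int k"
      using neg_int_cases[of x] by (metis not_le)
    obtain u where u: "u \<notin> \<Lambda>"
      using ne by auto
    \<comment> \<open>Subtracting \<open>k\<close> preserves \<open>\<Lambda>\<close>, so no member of the progression \<open>u + k n\<close> is in
      \<open>\<Lambda>\<close>, contradicting the finiteness of the complement.\<close>
    have "u + k * n \<notin> \<Lambda>" for n
    proof (induction n)
      case 0
      show ?case using u by simp
    next
      case (Suc n)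
      show ?case
      proof
        assume "u + k * Suc n \<in> \<Lambda>"
        with \<open>k > 0\<close> have "u + k * Suc n \<in> \<Lambda> - {0}"
          by simp
        with x have "x + int (u + k * Suc n) \<in> int ` \<Lambda>"
          unfolding pseudo_frobenius_def by blast
        moreover have "x + int (u + k * Suc n) = int (u + k * n)"
          using k by simp
        ultimately show False using Suc by (auto simp only: image_iff of_nat_eq_iff)
      qed
    qed
    then have "range (\<lambda>n. u + k * n) \<subseteq> gaps \<Lambda>"
      by (auto simp: gaps_def)
    moreover have "inj (\<lambda>n. u + k * n)"
      using k by (auto intro: injI)
    ultimately show False
      using finite_subset[OF _ fin] finite_imageD infinite_UNIV_nat by blast
  qed
  then obtain n where "x = int n"
    by (metis nonneg_int_cases)
  with x show "x \<in> int ` gaps \<Lambda>"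
    by (auto simp: pseudo_frobenius_def gaps_def)
qed

text \<open>For a gap \<open>x\<close> all sums \<open>x + y\<close> are natural numbers, so the
  integer condition fails exactly when some sum is again a gap.\<close>

lemma gaps_minus_pseudo_frobenius:
  "int ` gaps \<Lambda> - pseudo_frobenius \<Lambda> =
    {int x | x. x \<in> gaps \<Lambda> \<and> (\<exists>y \<in> \<Lambda> - {0}. x + y \<in> gaps \<Lambda>)}"
proof -
  have "int x \<in> pseudo_frobenius \<Lambda> \<longleftrightarrow> (\<forall>y \<in> \<Lambda> - {0}. x + y \<notin> gaps \<Lambda>)" if "x \<in> gaps \<Lambda>" for x
    using that unfolding pseudo_frobenius_def gaps_def
    by (auto simp: image_iff simp flip: of_nat_add)
  then show ?thesis by blast
qed

lemma gaps_Lambda_minus_pseudo_frobenius: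
  assumes g: "3 * l \<le> g + 1" and v: "\<forall>i\<in>{1..2 * l}. v i \<in> {0, 1}"
  shows "int ` gaps (Lambda l g v) - pseudo_frobenius (Lambda l g v) =
    {int j - int i | i j. 1 \<le> i \<and> i < j \<and> j \<le> 2 * l \<and> v i = 0 \<and> v j = 1}"
    (is "_ = ?D")
proof -
  have "int x \<in> ?D"
    if x: "x \<in> gap_set l g v" and y: "y \<in> Lambda l g v" "y \<noteq> 0" "x + y \<in> gap_set l g v" for x y
  proof -
    have "x > 0"
      using x by (auto simp: gap_set_def)
    have "y > g - l"
      using y by (auto simp: Lambda_def gap_set_def)
    define i where "i = y - (g - l)"
    have i: "y = g - l + i" "i \<ge> 1"
      using \<open>y > g - l\<close> by (auto simp: i_def)
    obtain j where j: "x + y = g - l + j" "j \<le> 2 * l" "v j = 1"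
      using y(3) i by (auto simp: gap_set_def)
    have "i < j"
      using i j \<open>x > 0\<close> by linarith
    \<comment> \<open>Otherwise \<open>y\<close>, at position \<open>i\<close> of the window, would
      itself be a gap.\<close>
    have "v i \<noteq> 1"
      using y(1) i \<open>i < j\<close> j(2) by (auto simp: Lambda_def gap_set_def)
    then have "v i = 0"
      using v i \<open>i < j\<close> j(2) by auto
    moreover have "int x = int j - int i"
      using i(1) j(1) by linarith
    ultimately show ?thesis
      using i(2) \<open>i < j\<close> j by blast
  qed
  moreover have "\<exists>x. int j - int i = int x \<and> x \<in> gap_set l g v \<and>
      (\<exists>y \<in> Lambda l g v - {0}. x + y \<in> gap_set l g v)"
    if ij: "1 \<le> i" "i < j" "j \<le> 2 * l" "v i = 0" "v j = 1" for i j
  proof (intro exI conjI bexI)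
    show "int j - int i = int (j - i)"
      using ij by simp
    have "j - i \<le> g - l"
      using ij g by linarith
    then show "j - i \<in> gap_set l g v"
      using ij by (auto simp: gap_set_def)
    \<comment> \<open>The witness is the element at window position \<open>i\<close>, in \<Lambda>
      because \<open>v i = 0\<close>; adding \<open>j - i\<close> moves it to the gap at position
      \<open>j\<close>.\<close>
    show "g - l + i \<in> Lambda l g v - {0}"
      using ij by (auto simp: Lambda_def gap_set_def)
    have "j - i + (g - l + i) = g - l + j"
      using ij by simp
    then show "j - i + (g - l + i) \<in> gap_set l g v"
      using ij by (auto simp: gap_set_def)
  qed
  ultimately show ?thesis
    unfolding gaps_minus_pseudo_frobenius unfolding gaps_Lambda by blast
qed

theorem proposition3p3:
  fixes l g :: nat and v :: "nat \<Rightarrow> nat"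
  assumes "l \<ge> 1"
    and "g \<ge> 3 * l - 1"
    and "\<forall>i\<in>{1..2 * l}. v i \<in> {0, 1}"
    and "card {i \<in> {1..2 * l}. v i = 0} = l"
    and "card {i \<in> {1..2 * l}. v i = 1} = l"
  shows "(numerical_semigroup (Lambda l g v) \<and> genus (Lambda l g v) = g)
    \<and> int ` gaps (Lambda l g v) - pseudo_frobenius (Lambda l g v)
        = {int j - int i | i j. 1 \<le> i \<and> i < j \<and> j \<le> 2 * l \<and> v i = 0 \<and> v j = 1}
    \<and> int (semigroup_type (Lambda l g v))
        = int g - int (card {int j - int i | i j.
            1 \<le> i \<and> i < j \<and> j \<le> 2 * l \<and> v i = 0 \<and> v j = 1})"
proof -
  let ?\<Lambda> = "Lambda l g v"
  let ?D = "{int j - int i | i j. 1 \<le> i \<and> i < j \<and> j \<le> 2 * l \<and> v i = 0 \<and> v j = 1}"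
  have g: "3 * l \<le> g + 1"
    using assms(2) by linarith
  have genus: "genus ?\<Lambda> = g"
    using assms(1,2,5) by (simp add: genus_def card_gap_set)
  have D: "int ` gaps ?\<Lambda> - pseudo_frobenius ?\<Lambda> = ?D"
    by (rule gaps_Lambda_minus_pseudo_frobenius[OF g assms(3)])
  \<comment> \<open>\<open>g - l \<ge> 2 * l - 1 \<ge> 1\<close> puts 1 in the initial block of
    gaps, so \<Lambda> is not \<open>UNIV\<close>.\<close>
  have "1 \<notin> ?\<Lambda>"
    using assms(1,2) by (auto simp: Lambda_def gap_set_def)
  then have "pseudo_frobenius ?\<Lambda> \<subseteq> int ` gaps ?\<Lambda>"
    by (intro pseudo_frobenius_subset_gaps) auto
  then have PF: "pseudo_frobenius ?\<Lambda> = int ` gaps ?\<Lambda> - ?D"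
    unfolding D[symmetric] by blast
  have sub: "?D \<subseteq> int ` gaps ?\<Lambda>"
    unfolding D[symmetric] by blast
  have fin: "finite (int ` gaps ?\<Lambda>)" and card: "card (int ` gaps ?\<Lambda>) = g"
    using genus by (simp_all add: card_image genus_def)
  have "semigroup_type ?\<Lambda> = g - card ?D"
    unfolding semigroup_type_def PF
    using card_Diff_subset[OF finite_subset[OF sub fin] sub] card by simp
  \<comment> \<open>This makes the truncated difference \<open>g - card ?D\<close> agree with the
    integer one.\<close>
  moreover have "card ?D \<le> g"
    using card_mono[OF fin sub] card by simp
  ultimately have "int (semigroup_type ?\<Lambda>) = int g - int (card ?D)"
    by simp
  with numerical_semigroup_Lambda[OF g] genus D show ?thesis
    by (intro conjI)
qed

end
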